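(* Let $k\ge1$ be an integer, let $G$ be a graph of order $n$ with minimum degree $\delta$, and put $\bar\delta=\delta-k$ and $b_{k-1}=\binom{\delta}{k-1}$. If $\bar\delta>0$, then $$\gamma_k^{\mathrm t}(G)\le\left(1-\frac{\bar\delta}{(1+\bar\delta)^{1+1/\bar\delta}\;b_{k-1}^{1/\bar\delta}}\right)n .$$ Also, if $\delta\ge k$, then $$\gamma_k^{\mathrm t}(G)\le\frac{\ln(\delta-k+1)+\ln b_{k-1}+1}{\delta-k+1}\,n .$$
   Context: All graphs are finite, undirected, without loops and multiple edges (and nonempty). $N(v)$ denotes the open neighbourhood of $v$ (the set of neighbours of $v$). A set $X\subseteq V(G)$ is a total $k$-dominating set of $G$ if $|N(v)\cap X|\ge k$ for every vertex $v\in V(G)$. The total $k$-domination number $\gamma_k^{\mathrm t}(G)$ is the minimum cardinality of a total $k$-dominating set of $G$; it is defined for graphs with minimum degree at least $k$. *)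

theory Defs
  imports Complex_Main "Graph_Theory.Pair_Digraph"
begin

text \<open>
  A finite undirected simple graph is a \<^locale>\<open>pair_graph\<close>: finite, loop-free, without parallel
  arcs, and with a symmetric arc set, so that an undirected edge between \<open>u\<close> and \<open>v\<close> is the pair of
  arcs \<open>(u, v)\<close> and \<open>(v, u)\<close>. The degree of a vertex is then its out-degree.
\<close>

definition neighbourhood :: "'a pair_pre_digraph \<Rightarrow> 'a \<Rightarrow> 'a set" where
  "neighbourhood G v = {w. (v, w) \<in> parcs G}"

lemma out_degree_eq_card_neighbourhood:
  fixes G :: "'a pair_pre_digraph"
  shows "out_degree (with_proj G) v = card (neighbourhood G v)"
proof -
  have "out_arcs (with_proj G) v = Pair v ` neighbourhood G v"
    by (auto simp: out_arcs_def neighbourhood_def)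
  then show ?thesis
    by (simp add: out_degree_def card_image inj_on_def)
qed

definition min_degree :: "'a pair_pre_digraph \<Rightarrow> nat" where
  "min_degree G = Min (out_degree (with_proj G) ` pverts G)"

definition total_dominating :: "nat \<Rightarrow> 'a pair_pre_digraph \<Rightarrow> 'a set \<Rightarrow> bool" where
  "total_dominating k G X \<longleftrightarrow>
     X \<subseteq> pverts G \<and> (\<forall>v\<in>pverts G. card (neighbourhood G v \<inter> X) \<ge> k)"

text \<open>
  The total \<open>k\<close>-domination number is meaningful only for minimum degree at least \<open>k\<close>; otherwise
  there is no total \<open>k\<close>-dominating set and the minimum below is taken over the empty set.
\<close>

definition total_domination_number :: "nat \<Rightarrow> 'a pair_pre_digraph \<Rightarrow> nat" where
  "total_domination_number k G = Min (card ` {X. total_dominating k G X})"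

lemma total_dominating_pverts:
  assumes "pair_graph G" and "k \<le> min_degree G"
  shows "total_dominating k G (pverts G)"
proof -
  interpret pair_graph G by fact
  have "k \<le> card (neighbourhood G v \<inter> pverts G)" if "v \<in> pverts G" for v
  proof -
    have "min_degree G \<le> out_degree (with_proj G) v"
      using that pair_finite_verts unfolding min_degree_def by (intro Min_le) auto
    moreover have "neighbourhood G v \<inter> pverts G = neighbourhood G v"
      by (auto simp: neighbourhood_def dest: in_arcsD2)
    ultimately show ?thesis
      using assms(2) by (simp add: out_degree_eq_card_neighbourhood)
  qed
  then show ?thesis by (simp add: total_dominating_def)
qed

end

theory Submission
  imports Defs
begin

text \<open>
  The proof is probabilistic. Put every vertex into a random set \<open>X\<close> independently with probability
  \<open>p\<close>, and repair \<open>X\<close>: a vertex \<open>v\<close> with only \<open>i < k\<close> neighbours in \<open>X\<close> receives \<open>k - i\<close> further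
  neighbours. To bound the expected deficit \<open>k - i\<close>, fix a set \<open>S\<close> of \<open>\<delta>\<close> neighbours of \<open>v\<close> and count
  the \<open>(k-1)\<close>-subsets \<open>T\<close> of \<open>S\<close> such that \<open>X\<close> misses \<open>S - T\<close>. There are at least as many of them as
  the deficit (lemma \<open>deficit_le_card_witnesses\<close>), and each of the \<open>\<delta> choose (k-1)\<close> candidates
  qualifies with probability \<open>(1-p)^(\<delta>-k+1)\<close>. Hence, for every \<open>p\<close> in the unit interval,
  \<open>\<gamma> \<le> (p + b * (1-p)^(\<delta>-k+1)) * n\<close> with \<open>b = \<delta> choose (k-1)\<close>
  (lemma \<open>total_domination_number_le_random\<close>).

  Both bounds are choices of \<open>p\<close>. Setting the derivative to zero gives
  \<open>1 - p = ((1+\<delta>') * b) powr (-1/\<delta>')\<close> and the first bound. Replacing \<open>1 - p\<close> by \<open>exp (-p)\<close> before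
  minimising gives \<open>p = (ln (\<delta>-k+1) + ln b) / (\<delta>-k+1)\<close> and the second; if that value exceeds \<open>1\<close>,
  the second bound exceeds \<open>n\<close> and is trivial.
\<close>

section \<open>Random subsets of a finite set\<close>

text \<open>The probability that a random subset of \<open>V\<close>, containing each element independently with
  probability \<open>p\<close>, equals \<open>X\<close>.\<close>

definition subset_weight :: "'a set \<Rightarrow> real \<Rightarrow> 'a set \<Rightarrow> real" where
  "subset_weight V p X = p ^ card X * (1 - p) ^ card (V - X)"

lemma subset_weight_nonneg: "0 \<le> p \<Longrightarrow> p \<le> 1 \<Longrightarrow> 0 \<le> subset_weight V p X"
  by (simp add: subset_weight_def)

text \<open>Expand the product over \<open>V\<close> of \<open>p + (1 - p)\<close>, with \<open>p\<close> replaced by \<open>0\<close> on \<open>D\<close>: the terms that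
  survive belong to the sets avoiding \<open>D\<close>.\<close>

lemma prob_avoid:
  assumes "finite V" "D \<subseteq> V"
  shows "(\<Sum>X\<in>Pow V. subset_weight V p X * of_bool (X \<inter> D = {})) = (1 - p) ^ card D"
proof -
  define f where "f i = (if i \<in> D then 0 else p)" for i
  have summand: "(\<Prod>i\<in>X. f i) * (\<Prod>i\<in>V - X. 1 - p) = subset_weight V p X * of_bool (X \<inter> D = {})"
    if "X \<in> Pow V" for X
  proof (cases "X \<inter> D = {}")
    case True
    then have "(\<Prod>i\<in>X. f i) = (\<Prod>i\<in>X. p)"
      by (intro prod.cong) (auto simp: f_def)
    then show ?thesis
      using True by (simp add: subset_weight_def)
  next
    case False
    have "finite X"
      using that assms(1) finite_subset by auto
    then have "(\<Prod>i\<in>X. f i) = 0"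
      using False by (auto simp: f_def)
    then show ?thesis
      using False by simp
  qed
  have "(1 - p) ^ card D = (\<Prod>i\<in>D. 1 - p)"
    by simp
  also have "\<dots> = (\<Prod>i\<in>V. f i + (1 - p))"
    using assms by (intro prod.mono_neutral_cong_left) (auto simp: f_def)
  also have "\<dots> = (\<Sum>X\<in>Pow V. (\<Prod>i\<in>X. f i) * (\<Prod>i\<in>V - X. 1 - p))"
    using assms(1) by (rule prod_add)
  also have "\<dots> = (\<Sum>X\<in>Pow V. subset_weight V p X * of_bool (X \<inter> D = {}))"
    by (rule sum.cong[OF refl summand])
  finally show ?thesis ..
qed

lemma sum_subset_weight:
  assumes "finite V"
  shows "(\<Sum>X\<in>Pow V. subset_weight V p X) = 1"
  using prob_avoid[OF assms, of "{}" p] by simp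

lemma expectation_card:
  assumes "finite V"
  shows "(\<Sum>X\<in>Pow V. subset_weight V p X * real (card X)) = p * real (card V)"
proof -
  have card_eq: "real (card X) = (\<Sum>v\<in>V. 1 - of_bool (X \<inter> {v} = {}))" if "X \<in> Pow V" for X
  proof -
    have "(\<Sum>v\<in>V. 1 - of_bool (X \<inter> {v} = {})) = (\<Sum>v\<in>V. if v \<in> X then 1 else (0::real))"
      by (intro sum.cong) auto
    also have "\<dots> = real (card (V \<inter> X))"
      using assms by (simp flip: sum.inter_restrict)
    finally show ?thesis
      using that by (simp add: Int_absorb1)
  qed
  have "(\<Sum>X\<in>Pow V. subset_weight V p X * real (card X))
      = (\<Sum>X\<in>Pow V. \<Sum>v\<in>V. subset_weight V p X * (1 - of_bool (X \<inter> {v} = {})))"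
    by (intro sum.cong) (simp_all only: card_eq sum_distrib_left)
  also have "\<dots> = (\<Sum>v\<in>V. \<Sum>X\<in>Pow V.
      subset_weight V p X - subset_weight V p X * of_bool (X \<inter> {v} = {}))"
    by (subst sum.swap) (simp only: right_diff_distrib mult_1_right)
  also have "\<dots> = (\<Sum>v\<in>V. 1 - (1 - p) ^ card {v})"
  proof (intro sum.cong refl)
    fix v assume "v \<in> V"
    then show "(\<Sum>X\<in>Pow V. subset_weight V p X - subset_weight V p X * of_bool (X \<inter> {v} = {}))
        = 1 - (1 - p) ^ card {v}"
      using prob_avoid[OF assms, of "{v}" p] sum_subset_weight[OF assms, of p]
      by (simp only: sum_subtractf) simp
  qed
  finally show ?thesis
    by (simp add: mult.commute)
qed

section \<open>Deficits and their repair\<close>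

definition deficit_witnesses :: "nat \<Rightarrow> 'a set \<Rightarrow> 'a set \<Rightarrow> 'a set set" where
  "deficit_witnesses k S X = {T. T \<subseteq> S \<and> card T = k - 1 \<and> X \<inter> (S - T) = {}}"

text \<open>Extend \<open>S \<inter> X\<close> to a \<open>k\<close>-subset \<open>B\<close> of \<open>S\<close>. Removing any element outside \<open>X\<close> from \<open>B\<close> leaves a
  witness, and there are \<open>k - card (S \<inter> X)\<close> such elements.\<close>

lemma deficit_le_card_witnesses:
  assumes "finite S" "k \<le> card S"
  shows "k - card (S \<inter> X) \<le> card (deficit_witnesses k S X)"
proof (cases "card (S \<inter> X) \<le> k")
  case True
  obtain B where B: "S \<inter> X \<subseteq> B" "B \<subseteq> S" "card B = k"
    using exists_subset_between[of "S \<inter> X" k S] True assms by auto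
  have "finite B"
    using B(2) assms(1) finite_subset by auto
  have "k - card (S \<inter> X) = card (B - S \<inter> X)"
    using B card_Diff_subset[of "S \<inter> X" B] assms(1) by simp
  also have "\<dots> = card ((\<lambda>x. B - {x}) ` (B - S \<inter> X))"
    by (rule card_image[symmetric]) (auto simp: inj_on_def)
  also have "\<dots> \<le> card (deficit_witnesses k S X)"
  proof (rule card_mono)
    show "finite (deficit_witnesses k S X)"
      by (rule finite_subset[of _ "Pow S"]) (auto simp: deficit_witnesses_def assms)
    show "(\<lambda>x. B - {x}) ` (B - S \<inter> X) \<subseteq> deficit_witnesses k S X"
      using B \<open>finite B\<close> by (auto simp: deficit_witnesses_def)
  qed
  finally show ?thesis .
qed simp

lemma expected_card_witnesses:
  assumes "finite V" "S \<subseteq> V" "1 \<le> k" "k \<le> card S"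
  shows "(\<Sum>X\<in>Pow V. subset_weight V p X * real (card (deficit_witnesses k S X)))
    = real (card S choose (k - 1)) * (1 - p) ^ (card S - k + 1)"
proof -
  define C where "C = {T. T \<subseteq> S \<and> card T = k - 1}"
  have "finite S"
    using assms(1,2) finite_subset by auto
  then have "finite C"
    by (simp add: C_def)
  have card_eq: "real (card (deficit_witnesses k S X)) = (\<Sum>T\<in>C. of_bool (X \<inter> (S - T) = {}))" for X
  proof -
    have "deficit_witnesses k S X = {T \<in> C. X \<inter> (S - T) = {}}"
      by (auto simp: deficit_witnesses_def C_def)
    then show ?thesis
      using \<open>finite C\<close> by (simp add: of_bool_def sum.If_cases Int_def)
  qed
  have prob: "(\<Sum>X\<in>Pow V. subset_weight V p X * of_bool (X \<inter> (S - T) = {}))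
      = (1 - p) ^ (card S - k + 1)" if "T \<in> C" for T
  proof -
    have "T \<subseteq> S" "card T = k - 1"
      using that by (auto simp: C_def)
    then have "card (S - T) = card S - k + 1"
      using card_Diff_subset[of T S] \<open>finite S\<close> finite_subset[of T S] assms(3,4) by simp
    then show ?thesis
      using prob_avoid[OF assms(1), of "S - T" p] assms(2) by auto
  qed
  have "(\<Sum>X\<in>Pow V. subset_weight V p X * real (card (deficit_witnesses k S X)))
      = (\<Sum>T\<in>C. \<Sum>X\<in>Pow V. subset_weight V p X * of_bool (X \<inter> (S - T) = {}))"
    unfolding card_eq sum_distrib_left by (rule sum.swap)
  also have "\<dots> = (\<Sum>T\<in>C. (1 - p) ^ (card S - k + 1))"
    by (rule sum.cong[OF refl prob])
  also have "\<dots> = real (card S choose (k - 1)) * (1 - p) ^ (card S - k + 1)"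
    using n_subsets[OF \<open>finite S\<close>, of "k - 1"] by (simp add: C_def)
  finally show ?thesis .
qed

lemma ex_repair:
  assumes "finite V" "X \<subseteq> V"
    and "\<And>v. v \<in> V \<Longrightarrow> S v \<subseteq> V \<and> k \<le> card (S v)"
  shows "\<exists>Y. X \<subseteq> Y \<and> Y \<subseteq> V \<and> (\<forall>v\<in>V. k \<le> card (S v \<inter> Y))
    \<and> card Y \<le> card X + (\<Sum>v\<in>V. k - card (S v \<inter> X))"
proof -
  have fin: "finite A" if "A \<subseteq> V" for A
    using that assms(1) finite_subset by auto
  have "\<exists>A. A \<subseteq> S v - X \<and> card A = k - card (S v \<inter> X)" if "v \<in> V" for v
  proof -
    have "card (S v - X) = card (S v) - card (S v \<inter> X)"
      using assms(3)[OF that] fin by (simp add: card_Diff_subset_Int)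
    then have "k - card (S v \<inter> X) \<le> card (S v - X)"
      using assms(3)[OF that] by (simp add: diff_le_mono)
    then show ?thesis
      by (metis obtain_subset_with_card_n)
  qed
  then obtain A where A: "\<And>v. v \<in> V \<Longrightarrow> A v \<subseteq> S v - X \<and> card (A v) = k - card (S v \<inter> X)"
    by metis
  define Y where "Y = X \<union> (\<Union>v\<in>V. A v)"
  have "Y \<subseteq> V"
    using assms(2,3) A unfolding Y_def by blast
  have "k \<le> card (S v \<inter> Y)" if "v \<in> V" for v
  proof -
    have "k \<le> card (S v \<inter> X) + card (A v)"
      using A[OF that] by simp
    also have "\<dots> = card ((S v \<inter> X) \<union> A v)"
    proof (rule card_Un_disjoint[symmetric])
      show "finite (S v \<inter> X)" "finite (A v)"
        using assms(2,3) A that by (blast intro: fin)+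
    qed (use A[OF that] in auto)
    also have "\<dots> \<le> card (S v \<inter> Y)"
    proof (rule card_mono)
      show "finite (S v \<inter> Y)"
        using \<open>Y \<subseteq> V\<close> by (blast intro: fin)
    qed (use A[OF that] that in \<open>auto simp: Y_def\<close>)
    finally show ?thesis .
  qed
  moreover have "card Y \<le> card X + (\<Sum>v\<in>V. k - card (S v \<inter> X))"
  proof -
    have "card Y \<le> card X + card (\<Union>v\<in>V. A v)"
      unfolding Y_def by (rule card_Un_le)
    also have "card (\<Union>v\<in>V. A v) \<le> (\<Sum>v\<in>V. card (A v))"
      using assms(1) by (rule card_UN_le)
    finally show ?thesis
      using A by simp
  qed
  moreover have "X \<subseteq> Y"
    by (simp add: Y_def)
  ultimately show ?thesis
    using \<open>Y \<subseteq> V\<close> by blast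
qed

section \<open>Bounds on the total domination number\<close>

lemma total_domination_number_le:
  assumes "pair_graph G" "total_dominating k G X"
  shows "total_domination_number k G \<le> card X"
proof -
  interpret pair_graph G by fact
  have "finite {X. total_dominating k G X}"
    by (rule finite_subset[of _ "Pow (pverts G)"]) (auto simp: total_dominating_def)
  then show ?thesis
    using assms(2) unfolding total_domination_number_def by (intro Min_le) auto
qed

lemma min_degree_le_card_neighbourhood:
  assumes "pair_graph G" "v \<in> pverts G"
  shows "min_degree G \<le> card (neighbourhood G v)"
proof -
  interpret pair_graph G by fact
  show ?thesis
    using assms(2) unfolding min_degree_def
    by (intro Min_le) (auto simp flip: out_degree_eq_card_neighbourhood)
qed

text \<open>The domination number is at most the size of the repair of every single \<open>X\<close>, hence at most the
  weighted mean of these sizes. No particular \<open>X\<close> attaining the mean has to be selected.\<close>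

lemma total_domination_number_le_random:
  fixes p :: real
  assumes "pair_graph G" "1 \<le> k" "k \<le> min_degree G" "0 \<le> p" "p \<le> 1"
  shows "real (total_domination_number k G)
    \<le> (p + real (min_degree G choose (k - 1)) * (1 - p) ^ (min_degree G - k + 1))
        * real (card (pverts G))"
proof -
  interpret pair_graph G by fact
  define V where "V = pverts G"
  define d where "d = min_degree G"
  define N where "N = total_domination_number k G"
  define w where "w = subset_weight V p"
  have "finite V"
    by (simp add: V_def)
  \<comment> \<open>Restricting every neighbourhood to exactly \<open>d\<close> elements gives every vertex the same
    expected number of witnesses.\<close>
  have "\<exists>S. S \<subseteq> neighbourhood G v \<and> card S = d" if "v \<in> V" for v
    using min_degree_le_card_neighbourhood[OF assms(1), of v] that
    by (metis V_def d_def obtain_subset_with_card_n)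
  then obtain S where S: "\<And>v. v \<in> V \<Longrightarrow> S v \<subseteq> neighbourhood G v \<and> card (S v) = d"
    by metis
  have S_sub: "S v \<subseteq> V" if "v \<in> V" for v
    using S[OF that] by (auto simp: neighbourhood_def V_def dest: in_arcsD2)
  have "real N \<le> real (card X) + (\<Sum>v\<in>V. real (card (deficit_witnesses k (S v) X)))"
    if "X \<subseteq> V" for X
  proof -
    have "S v \<subseteq> V \<and> k \<le> card (S v)" if "v \<in> V" for v
      using S[OF that] S_sub[OF that] assms(3) by (simp add: d_def)
    then obtain Y where Y: "Y \<subseteq> V" "\<forall>v\<in>V. k \<le> card (S v \<inter> Y)"
        "card Y \<le> card X + (\<Sum>v\<in>V. k - card (S v \<inter> X))"
      using ex_repair[OF \<open>finite V\<close> \<open>X \<subseteq> V\<close>, of S k] by metis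
    have "k \<le> card (neighbourhood G v \<inter> Y)" if "v \<in> V" for v
    proof -
      have "card (S v \<inter> Y) \<le> card (neighbourhood G v \<inter> Y)"
        using S[OF that] Y(1) \<open>finite V\<close> by (intro card_mono) (auto dest: finite_subset)
      then show ?thesis
        using Y(2) that by fastforce
    qed
    then have "N \<le> card Y"
      unfolding N_def using Y(1)
      by (intro total_domination_number_le[OF assms(1)]) (auto simp: total_dominating_def V_def)
    also note Y(3)
    also have "(\<Sum>v\<in>V. k - card (S v \<inter> X)) \<le> (\<Sum>v\<in>V. card (deficit_witnesses k (S v) X))"
    proof (intro sum_mono deficit_le_card_witnesses)
      fix v assume "v \<in> V"
      show "finite (S v)"
        using S_sub[OF \<open>v \<in> V\<close>] \<open>finite V\<close> finite_subset by auto
      show "k \<le> card (S v)"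
        using S[OF \<open>v \<in> V\<close>] assms(3) by (simp add: d_def)
    qed
    finally have "N \<le> card X + (\<Sum>v\<in>V. card (deficit_witnesses k (S v) X))"
      by simp
    then show ?thesis
      by (metis of_nat_add of_nat_le_iff of_nat_sum)
  qed
  then have le: "w X * real N
      \<le> w X * real (card X) + (\<Sum>v\<in>V. w X * real (card (deficit_witnesses k (S v) X)))"
    if "X \<in> Pow V" for X
    using that unfolding w_def sum_distrib_left[symmetric] distrib_left[symmetric]
    by (intro mult_left_mono subset_weight_nonneg assms(4,5)) auto
  have "real N = (\<Sum>X\<in>Pow V. w X * real N)"
    using sum_subset_weight[OF \<open>finite V\<close>, of p] by (simp add: w_def flip: sum_distrib_right)
  also have "\<dots> \<le> (\<Sum>X\<in>Pow V. w X * real (card X)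
      + (\<Sum>v\<in>V. w X * real (card (deficit_witnesses k (S v) X))))"
    by (rule sum_mono[OF le])
  also have "\<dots> = (\<Sum>X\<in>Pow V. w X * real (card X))
      + (\<Sum>v\<in>V. \<Sum>X\<in>Pow V. w X * real (card (deficit_witnesses k (S v) X)))"
    unfolding sum.distrib by (subst (2) sum.swap) (rule refl)
  also have "(\<Sum>v\<in>V. \<Sum>X\<in>Pow V. w X * real (card (deficit_witnesses k (S v) X)))
      = (\<Sum>v\<in>V. real (d choose (k - 1)) * (1 - p) ^ (d - k + 1))"
  proof (rule sum.cong[OF refl])
    fix v assume "v \<in> V"
    then show "(\<Sum>X\<in>Pow V. w X * real (card (deficit_witnesses k (S v) X)))
        = real (d choose (k - 1)) * (1 - p) ^ (d - k + 1)"
      using expected_card_witnesses[OF \<open>finite V\<close> S_sub, of v k p] S[of v] assms(2,3)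
      by (simp add: w_def d_def)
  qed
  also have "(\<Sum>X\<in>Pow V. w X * real (card X)) = p * real (card V)"
    unfolding w_def using \<open>finite V\<close> by (rule expectation_card)
  finally show ?thesis
    by (simp add: N_def V_def d_def algebra_simps)
qed

text \<open>The minimum over \<open>q\<close> of \<open>1 - q + b * q powr (m + 1)\<close>: at the critical point
  \<open>(1 + m) * b * q powr m = 1\<close>, so the last term equals \<open>q / (1 + m)\<close>.\<close>

lemma critical_point_value:
  fixes m b :: real
  assumes "0 < m" "1 \<le> b"
  defines "q \<equiv> ((1 + m) * b) powr (- (1 / m))"
  shows "0 < q" "q \<le> 1"
    and "1 - q + b * q powr (m + 1) = 1 - m / ((1 + m) powr (1 + 1 / m) * b powr (1 / m))"
proof -
  have "1 * 1 \<le> (1 + m) * b"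
    using assms by (intro mult_mono) auto
  then have c: "1 \<le> (1 + m) * b"
    by simp
  have "1 + m \<noteq> 0" "b \<noteq> 0"
    using assms(1,2) by auto
  show "0 < q"
    unfolding q_def using assms(1,2) by simp
  have "ln q \<le> 0"
    unfolding q_def using c assms(1) by (simp add: ln_powr)
  then show "q \<le> 1"
    using \<open>0 < q\<close> by simp
  have "q powr m = 1 / ((1 + m) * b)"
    unfolding q_def powr_powr using c assms(1) by (simp add: powr_minus_divide)
  then have "b * q powr (m + 1) = b * (1 / ((1 + m) * b)) * q"
    using \<open>0 < q\<close> by (simp add: powr_add)
  also have "\<dots> = q / (1 + m)"
    using \<open>b \<noteq> 0\<close> by simp
  finally have "1 - q + b * q powr (m + 1) = 1 - (q - q / (1 + m))"
    by simp
  also have "q - q / (1 + m) = m * (q / (1 + m))"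
    using \<open>1 + m \<noteq> 0\<close> by (simp add: field_simps)
  also have "m * (q / (1 + m)) = m / ((1 + m) powr (1 + 1 / m) * b powr (1 / m))"
    unfolding q_def using assms(1,2) by (simp add: powr_minus_divide powr_mult powr_add mult_ac)
  finally show "1 - q + b * q powr (m + 1) = 1 - m / ((1 + m) powr (1 + 1 / m) * b powr (1 / m))" .
qed

theorem corollary5:
  fixes G :: "'a pair_pre_digraph" and k n \<delta> :: nat and \<delta>' b :: real
  assumes "k \<ge> 1"
    and "pair_graph G" and "pverts G \<noteq> {}"
    and "n = card (pverts G)"
    and "\<delta> = min_degree G"
    and "\<delta>' = real \<delta> - real k"
    and "b = real (\<delta> choose (k - 1))"
  shows "(\<delta>' > 0 \<longrightarrow>
           real (total_domination_number k G)
             \<le> (1 - \<delta>' / ((1 + \<delta>') powr (1 + 1 / \<delta>') * b powr (1 / \<delta>'))) * real n)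
       \<and> (\<delta> \<ge> k \<longrightarrow>
           real (total_domination_number k G)
             \<le> (ln (real \<delta> - real k + 1) + ln b + 1) / (real \<delta> - real k + 1) * real n)"
proof (intro conjI impI)
  have b_ge_1: "1 \<le> b" if "k \<le> \<delta>"
  proof -
    have "0 < \<delta> choose (k - 1)"
      using that by simp
    then show ?thesis
      using assms(7) by linarith
  qed
  have random: "real (total_domination_number k G)
      \<le> (p + b * (1 - p) ^ (\<delta> - k + 1)) * real n" if "k \<le> \<delta>" "0 \<le> p" "p \<le> 1" for p
    using total_domination_number_le_random[of G k p] that assms(1,2,4,5,7) by simp
  {
    assume pos: "\<delta>' > 0"
    then have "k \<le> \<delta>"
      using assms(6) by simp
    note crit = critical_point_value[OF pos b_ge_1[OF \<open>k \<le> \<delta>\<close>]]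
    define q where "q = ((1 + \<delta>') * b) powr (- (1 / \<delta>'))"
    have "q ^ (\<delta> - k + 1) = q powr (\<delta>' + 1)"
      using crit(1) assms(6) \<open>k \<le> \<delta>\<close> unfolding q_def[symmetric]
      by (simp add: of_nat_diff powr_add flip: powr_realpow)
    then show "real (total_domination_number k G)
        \<le> (1 - \<delta>' / ((1 + \<delta>') powr (1 + 1 / \<delta>') * b powr (1 / \<delta>'))) * real n"
      using random[of "1 - q"] crit \<open>k \<le> \<delta>\<close> unfolding q_def[symmetric] by simp
  next
    assume "k \<le> \<delta>"
    define r where "r = \<delta> - k + 1"
    have r: "real \<delta> - real k + 1 = real r" "1 \<le> real r"
      using \<open>k \<le> \<delta>\<close> by (auto simp: r_def of_nat_diff)
    define p where "p = (ln (real r) + ln b) / real r"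
    have b: "1 \<le> b"
      using b_ge_1 \<open>k \<le> \<delta>\<close> .
    have "0 \<le> p"
      unfolding p_def using b r(2) by simp
    have bound: "(ln (real r) + ln b + 1) / real r = p + 1 / real r"
      by (simp add: p_def add_divide_distrib)
    have "real (total_domination_number k G) \<le> (p + 1 / real r) * real n"
    proof (cases "p \<le> 1")
      case True
      have "b * (1 - p) ^ r \<le> b * exp (- p) ^ r"
        using True b exp_ge_add_one_self[of "- p"] by (intro mult_left_mono power_mono) auto
      also have "exp (- p) ^ r = exp (- (ln (real r) + ln b))"
        unfolding exp_of_nat_mult[symmetric] using r(2) by (simp add: p_def)
      also have "\<dots> = 1 / (real r * b)"
        using b r(2) by (simp only: exp_minus exp_add) (simp add: inverse_eq_divide)
      also have "b * (1 / (real r * b)) = 1 / real r"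
        using b by simp
      finally have "(p + b * (1 - p) ^ r) * real n \<le> (p + 1 / real r) * real n"
        by (intro mult_right_mono) auto
      then show ?thesis
        using random[OF \<open>k \<le> \<delta>\<close> \<open>0 \<le> p\<close> True] by (simp add: r_def)
    next
      case False
      have "total_domination_number k G \<le> n"
        using total_domination_number_le[OF assms(2) total_dominating_pverts[OF assms(2)]]
          \<open>k \<le> \<delta>\<close> assms(4,5) by simp
      also have "1 * real n \<le> (p + 1 / real r) * real n"
        using False r(2) by (intro mult_right_mono) (auto intro: add_increasing2)
      finally show ?thesis
        by simp
    qed
    then show "real (total_domination_number k G)
        \<le> (ln (real \<delta> - real k + 1) + ln b + 1) / (real \<delta> - real k + 1) * real n"
      unfolding r(1) bound .
  }
qed

end
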